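(* Let $T>0$ and let $f:\mathbb{R}\to\mathbb{R}$ be a nonzero $T$-periodic function such that $f\in\mathcal{L}^1_{\mathrm{loc}}(\mathbb{R})$. Then the Caputo derivative ${}^{c}D^{\alpha}f$ cannot be $T$-periodic for any $\alpha\in(0,1)$. The same result holds for the fractional (Riemann–Liouville) derivative $D^{\alpha}f$.
   Context: For $\beta\in(0,1)$ and $g:\mathbb{R}\to\mathbb{R}$, the fractional integral of $g$ of order $\beta$ is $$I^{\beta}g(t)=\frac{1}{\Gamma(\beta)}\int_0^t (t-s)^{\beta-1}g(s)\,ds,$$ provided the right-hand side is defined for a.e. $t\in\mathbb{R}$. For $\alpha\in(0,1)$, the Riemann–Liouville derivative of $f$ of order $\alpha$ is $$D^{\alpha}f(t)=\frac{d}{dt}I^{1-\alpha}f(t)=\frac{1}{\Gamma(1-\alpha)}\frac{d}{dt}\int_0^t (t-s)^{-\alpha}f(s)\,ds,$$ and the Caputo derivative of $f$ of order $\alpha$ is $${}^{c}D^{\alpha}f(t)=I^{1-\alpha}f'(t)=\frac{1}{\Gamma(1-\alpha)}\int_0^t (t-s)^{-\alpha}f'(s)\,ds,$$ which is well defined, for example, for absolutely continuous functions. A function $g$ is $T$-periodic if $g(t+T)=g(t)$ for all $t$.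
   Formalization: "Nonzero" means not a.e. zero; for the Caputo derivative it is also assumed that f' is not a.e. zero (for absolutely continuous f: f not constant), since a nonzero constant f has Caputo derivative 0, which is T-periodic. *)

theory Defs
  imports "HOL-Analysis.Analysis" "HOL-Library.Periodic_Fun"
begin

definition locally_integrable :: "(real \<Rightarrow> real) \<Rightarrow> bool" where
  "locally_integrable f \<longleftrightarrow> (\<forall>a b. f absolutely_integrable_on {a..b})"

text \<open>
  The fractional integral is a partial function of \<open>t\<close>: \<open>frac_int_exists\<close> describes its
  domain, and \<open>frac_int\<close> is to be read as its value only there. The kernel
  \<open>(t - s) powr (\<beta> - 1)\<close> is real only for \<open>s < t\<close>, so the domain lies in \<open>t \<ge> 0\<close>.
\<close>

definition frac_int_exists :: "real \<Rightarrow> (real \<Rightarrow> real) \<Rightarrow> real \<Rightarrow> bool" where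
  "frac_int_exists \<beta> g t \<longleftrightarrow>
     0 \<le> t \<and> (\<lambda>s. (t - s) powr (\<beta> - 1) * g s) absolutely_integrable_on {0..t}"

definition frac_int :: "real \<Rightarrow> (real \<Rightarrow> real) \<Rightarrow> real \<Rightarrow> real" where
  "frac_int \<beta> g t =
     1 / Gamma \<beta> * (LINT s:{0..t}|lebesgue. (t - s) powr (\<beta> - 1) * g s)"

text \<open>
  For the Riemann-Liouville derivative, \<open>rl_deriv_exists\<close> only asks for differentiability of the
  totalised function \<open>frac_int (1 - \<alpha>) f\<close> at \<open>t\<close>; it does not ask for the fractional integral to
  exist on a whole neighbourhood of \<open>t\<close>, so it is the weaker of the two possible requirements.
\<close>

definition rl_deriv_exists :: "real \<Rightarrow> (real \<Rightarrow> real) \<Rightarrow> real \<Rightarrow> bool" where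
  "rl_deriv_exists \<alpha> f t \<longleftrightarrow>
     frac_int_exists (1 - \<alpha>) f t \<and> frac_int (1 - \<alpha>) f differentiable (at t)"

definition rl_deriv :: "real \<Rightarrow> (real \<Rightarrow> real) \<Rightarrow> real \<Rightarrow> real" where
  "rl_deriv \<alpha> f t = deriv (frac_int (1 - \<alpha>) f) t"

text \<open>
  The Caputo derivative makes sense only if \<open>f'\<close> exists almost everywhere; the values of
  \<open>deriv f\<close> on the remaining null set do not influence the integral.
\<close>

definition caputo_deriv_exists :: "real \<Rightarrow> (real \<Rightarrow> real) \<Rightarrow> real \<Rightarrow> bool" where
  "caputo_deriv_exists \<alpha> f t \<longleftrightarrow>
     (AE s in lebesgue. 0 < s \<and> s < t \<longrightarrow> f differentiable (at s)) \<and>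
     frac_int_exists (1 - \<alpha>) (deriv f) t"

definition caputo_deriv :: "real \<Rightarrow> (real \<Rightarrow> real) \<Rightarrow> real \<Rightarrow> real" where
  "caputo_deriv \<alpha> f t = frac_int (1 - \<alpha>) (deriv f) t"

text \<open>
  Periodicity of a function \<open>g\<close> with domain \<open>{t. P t}\<close>, given up to null sets on the positive
  half-line, which is where the fractional operators live. Everywhere-defined and
  everywhere-periodic functions are a special case.
\<close>

definition ae_periodic :: "(real \<Rightarrow> bool) \<Rightarrow> (real \<Rightarrow> real) \<Rightarrow> real \<Rightarrow> bool" where
  "ae_periodic P g T \<longleftrightarrow>
     (AE t in lebesgue. 0 < t \<longrightarrow> P t) \<and> (AE t in lebesgue. 0 < t \<longrightarrow> g (t + T) = g t)"

definition caputo_periodic :: "real \<Rightarrow> (real \<Rightarrow> real) \<Rightarrow> real \<Rightarrow> bool" where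
  "caputo_periodic \<alpha> f T \<longleftrightarrow> ae_periodic (caputo_deriv_exists \<alpha> f) (caputo_deriv \<alpha> f) T"

definition rl_periodic :: "real \<Rightarrow> (real \<Rightarrow> real) \<Rightarrow> real \<Rightarrow> bool" where
  "rl_periodic \<alpha> f T \<longleftrightarrow> ae_periodic (rl_deriv_exists \<alpha> f) (rl_deriv \<alpha> f) T"

definition absolutely_continuous_on :: "real \<Rightarrow> real \<Rightarrow> (real \<Rightarrow> real) \<Rightarrow> bool" where
  "absolutely_continuous_on a b f \<longleftrightarrow>
     (\<forall>\<epsilon>>0. \<exists>\<delta>>0. \<forall>(n::nat) x y.
        (\<forall>i<n. a \<le> x i \<and> x i \<le> y i \<and> y i \<le> b) \<and>
        disjoint_family_on (\<lambda>i. {x i<..<y i}) {..<n} \<and>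
        (\<Sum>i<n. y i - x i) < \<delta>
        \<longrightarrow> (\<Sum>i<n. \<bar>f (y i) - f (x i)\<bar>) < \<epsilon>)"

definition locally_absolutely_continuous :: "(real \<Rightarrow> real) \<Rightarrow> bool" where
  "locally_absolutely_continuous f \<longleftrightarrow> (\<forall>a b. absolutely_continuous_on a b f)"

end

theory Submission
  imports Defs
begin

text \<open>
  Let \<open>g\<close> be \<open>T\<close>-periodic and \<open>0 < \<beta> < 1\<close>. Shifting the variable of integration by one period
  gives, for \<open>t > 0\<close>,
  \<open>\<Gamma>(\<beta>) (I\<^sup>\<beta> g (t + T) - I\<^sup>\<beta> g t) = \<integral>\<^bsub>-T\<^esub>\<^bsup>0\<^esup> (t - s)\<^bsup>\<beta>-1\<^esup> g(s) ds\<close>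
  (\<open>frac_int_shift_period\<close>): passing to \<open>t + T\<close> extends the memory of the integral by one earlier
  period. If \<open>I\<^sup>\<beta> g\<close> is periodic, the right-hand side vanishes for almost all \<open>t > 0\<close>. For large \<open>t\<close>,
  the binomial series turns it into \<open>t\<^bsup>\<beta>-1\<^esup>\<close> times a power series in \<open>-1/t\<close> whose coefficients are
  nonzero multiples of the moments \<open>\<integral> s\<^sup>n g(s) ds\<close>, because \<open>\<beta> - 1\<close> is not a natural number. Hence
  all moments of \<open>g\<close> on \<open>[-T, 0]\<close> vanish, and \<open>g = 0\<close> almost everywhere
  (\<open>AE_eq_0_if_power_kernel_integral_eq_0\<close>).

  For the Caputo derivative take \<open>g = f'\<close> and \<open>\<beta> = 1 - \<alpha>\<close>: periodicity forces \<open>f' = 0\<close> almost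
  everywhere, and an absolutely continuous \<open>f\<close> is then constant
  (\<open>absolutely_continuous_AE_deriv_0_imp_eq\<close>). The Riemann-Liouville derivative is the derivative
  of \<open>I\<^bsup>1-\<alpha>\<^esup> f\<close>; its periodicity says that the \<open>t\<close>-derivative of the integral above, for \<open>g = f\<close>,
  vanishes almost everywhere. That derivative is an integral of the same kind with exponent
  \<open>-\<alpha> - 1\<close>, so the same argument yields \<open>f = 0\<close> almost everywhere.
\<close>

section \<open>Functions with vanishing moments\<close>

lemma absolutely_integrable_continuous_mult:
  fixes h \<phi> :: "real \<Rightarrow> real"
  assumes "continuous_on {a..b} \<phi>" and "h absolutely_integrable_on {a..b}"
  shows "(\<lambda>s. \<phi> s * h s) absolutely_integrable_on {a..b}"
proof (rule absolutely_integrable_bounded_measurable_product_real)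
  show "\<phi> \<in> borel_measurable (lebesgue_on {a..b})"
    using assms(1) by (intro continuous_imp_measurable_on_sets_lebesgue) auto
  show "bounded (\<phi> ` {a..b})"
    using assms(1) compact_continuous_image compact_imp_bounded by blast
qed (use assms in auto)

lemma integrable_continuous_mult:
  fixes h \<phi> :: "real \<Rightarrow> real"
  assumes "continuous_on {a..b} \<phi>" and "h absolutely_integrable_on {a..b}"
  shows "(\<lambda>s. \<phi> s * h s) integrable_on {a..b}"
  using absolutely_integrable_continuous_mult[OF assms] by (rule set_lebesgue_integral_eq_integral(1))

text \<open>
  Vanishing moments say that \<open>h\<close> is orthogonal to all polynomials; by the Weierstrass approximation
  theorem it is then orthogonal to all continuous functions.
\<close>

lemma integral_mult_continuous_eq_0:
  fixes h \<phi> :: "real \<Rightarrow> real"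
  assumes h: "h absolutely_integrable_on {a..b}"
    and moments: "\<And>n. integral {a..b} (\<lambda>s. s ^ n * h s) = 0"
    and \<phi>: "continuous_on {a..b} \<phi>"
  shows "integral {a..b} (\<lambda>s. \<phi> s * h s) = 0"
proof -
  have int: "(\<lambda>s. \<psi> s * h s) integrable_on {a..b}" if "continuous_on {a..b} \<psi>" for \<psi> :: "real \<Rightarrow> real"
    using that h by (rule integrable_continuous_mult)
  have habs: "(\<lambda>s. \<bar>h s\<bar>) integrable_on {a..b}"
    using h by (auto simp: absolutely_integrable_on_def)
  have poly: "integral {a..b} (\<lambda>s. p s * h s) = 0" if p: "real_polynomial_function p" for p
  proof -
    obtain c n where p_eq: "p = (\<lambda>x. \<Sum>i\<le>n. c i * x ^ i)"
      using p unfolding real_polynomial_function_iff_sum by blast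
    have "integral {a..b} (\<lambda>s. p s * h s) = integral {a..b} (\<lambda>s. \<Sum>i\<le>n. c i * (s ^ i * h s))"
      by (simp add: p_eq sum_distrib_right mult.assoc)
    also have "\<dots> = (\<Sum>i\<le>n. c i * integral {a..b} (\<lambda>s. s ^ i * h s))"
    proof -
      have "(\<lambda>s. c i * (s ^ i * h s)) integrable_on {a..b}" for i
        by (intro integrable_on_mult_right int continuous_intros)
      then show ?thesis by (simp add: integral_sum)
    qed
    finally show ?thesis by (simp add: moments)
  qed
  define C where "C = integral {a..b} (\<lambda>s. \<bar>h s\<bar>)"
  have C: "C \<ge> 0" unfolding C_def by (rule integral_nonneg) (use habs in auto)
  have bound: "\<bar>integral {a..b} (\<lambda>s. \<phi> s * h s)\<bar> \<le> e * C" if "e > 0" for e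
  proof -
    obtain p where p: "real_polynomial_function p" "\<And>x. x \<in> {a..b} \<Longrightarrow> \<bar>\<phi> x - p x\<bar> < e"
      using Stone_Weierstrass_real_polynomial_function[OF _ \<phi> \<open>e > 0\<close>] by auto
    have pc: "continuous_on {a..b} p"
      using p(1) by (simp add: continuous_real_polymonial_function continuous_at_imp_continuous_on)
    have "integral {a..b} (\<lambda>s. \<phi> s * h s) = integral {a..b} (\<lambda>s. (\<phi> s - p s) * h s)"
      using integral_diff[OF int[OF \<phi>] int[OF pc]] poly[OF p(1)] by (simp add: left_diff_distrib)
    also have "norm \<dots> \<le> integral {a..b} (\<lambda>s. e * \<bar>h s\<bar>)"
    proof (rule integral_norm_bound_integral)
      show "(\<lambda>s. (\<phi> s - p s) * h s) integrable_on {a..b}"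
        by (intro int continuous_intros \<phi> pc)
      show "(\<lambda>s. e * \<bar>h s\<bar>) integrable_on {a..b}"
        by (intro integrable_on_mult_right habs)
      show "norm ((\<phi> s - p s) * h s) \<le> e * \<bar>h s\<bar>" if "s \<in> {a..b}" for s
        using p(2)[OF that] by (auto simp: abs_mult intro!: mult_right_mono)
    qed
    finally show ?thesis by (simp add: C_def)
  qed
  show ?thesis
  proof (rule ccontr)
    assume n: "integral {a..b} (\<lambda>s. \<phi> s * h s) \<noteq> 0"
    define x where "x = \<bar>integral {a..b} (\<lambda>s. \<phi> s * h s)\<bar>"
    have "x > 0" using n by (simp add: x_def)
    have "x \<le> x / (2 * (C + 1)) * C" unfolding x_def by (rule bound) (use n C in auto)
    also have "\<dots> \<le> x / 2" using C \<open>x > 0\<close> by (simp add: field_simps)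
    finally show False using \<open>x > 0\<close> by simp
  qed
qed

text \<open>
  Orthogonality passes from continuous functions to the bounded measurable function \<open>sgn \<circ> h\<close>, an
  almost everywhere limit of continuous functions with values in \<open>[-1, 1]\<close>; this gives
  \<open>\<integral>\<bar>h\<bar> = \<integral>sgn h \<cdot> h = 0\<close>.
\<close>

lemma AE_eq_0_if_moments_eq_0:
  fixes h :: "real \<Rightarrow> real"
  assumes h: "h absolutely_integrable_on {a..b}"
    and moments: "\<And>n. integral {a..b} (\<lambda>s. s ^ n * h s) = 0"
  shows "AE s in lebesgue. s \<in> {a..b} \<longrightarrow> h s = 0"
proof -
  have "h \<in> borel_measurable (lebesgue_on {a..b})"
    using h by (simp add: absolutely_integrable_measurable)
  then have "(\<lambda>s. sgn (h s)) \<in> borel_measurable (lebesgue_on {a..b})"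
    by measurable
  then have "(\<lambda>s. sgn (h s)) measurable_on {a..b}"
    by (simp add: measurable_on_iff_borel_measurable)
  then obtain N g where N: "negligible N" and g: "\<And>n. continuous_on UNIV (g n)"
    and lim: "\<And>x. x \<notin> N \<Longrightarrow> (\<lambda>n. g n x) \<longlonglongrightarrow> (if x \<in> {a..b} then sgn (h x) else 0)"
    unfolding measurable_on_def by blast
  define \<phi> where "\<phi> n x = max (-1) (min 1 (g n x))" for n :: nat and x
  have \<phi>: "continuous_on {a..b} (\<phi> n)" for n
    unfolding \<phi>_def by (intro continuous_intros continuous_on_subset[OF g]) auto
  have lim\<phi>: "(\<lambda>n. \<phi> n s) \<longlonglongrightarrow> sgn (h s)" if "s \<in> {a..b} - N" for s
  proof -
    have "(\<lambda>n. \<phi> n s) \<longlonglongrightarrow> max (-1) (min 1 (sgn (h s)))"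
      unfolding \<phi>_def using lim[of s] that by (intro tendsto_intros) auto
    also have "max (-1) (min 1 (sgn (h s))) = sgn (h s)" by (auto simp: sgn_real_def)
    finally show ?thesis .
  qed
  \<comment> \<open>Setting \<open>h\<close> to \<open>0\<close> on the exceptional null set makes the convergence below hold at every point.\<close>
  define h0 where "h0 s = (if s \<in> N then 0 else h s)" for s
  have h0: "h0 absolutely_integrable_on {a..b}"
    by (rule absolutely_integrable_spike[OF h N]) (auto simp: h0_def)
  have h0abs: "(\<lambda>s. \<bar>h0 s\<bar>) integrable_on {a..b}"
    using h0 by (auto simp: absolutely_integrable_on_def)
  have "integral {a..b} (\<lambda>s. s ^ n * h0 s) = 0" for n
    by (rule trans[OF integral_spike[OF N] moments[of n]]) (simp add: h0_def)
  then have zero: "integral {a..b} (\<lambda>s. \<phi> n s * h0 s) = 0" for n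
    by (rule integral_mult_continuous_eq_0[OF h0 _ \<phi>])
  have "(\<lambda>n. integral {a..b} (\<lambda>s. \<phi> n s * h0 s)) \<longlonglongrightarrow> integral {a..b} (\<lambda>s. \<bar>h0 s\<bar>)"
  proof (rule dominated_convergence(2)[OF _ h0abs])
    show "(\<lambda>s. \<phi> n s * h0 s) integrable_on {a..b}" for n
      using \<phi> h0 by (rule integrable_continuous_mult)
    show "norm (\<phi> n s * h0 s) \<le> \<bar>h0 s\<bar>" for n s
      by (auto simp: abs_mult \<phi>_def intro!: mult_left_le_one_le)
    show "(\<lambda>n. \<phi> n s * h0 s) \<longlonglongrightarrow> \<bar>h0 s\<bar>" if "s \<in> {a..b}" for s
    proof (cases "s \<in> N")
      case False
      then have "(\<lambda>n. \<phi> n s * h0 s) \<longlonglongrightarrow> sgn (h s) * h0 s"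
        using that by (intro tendsto_intros lim\<phi>) auto
      also have "sgn (h s) * h0 s = \<bar>h0 s\<bar>" using False by (auto simp: h0_def sgn_real_def)
      finally show ?thesis .
    qed (auto simp: h0_def)
  qed
  then have "integral {a..b} (\<lambda>s. \<bar>h0 s\<bar>) = 0"
    by (simp add: zero LIMSEQ_const_iff)
  moreover have h0abs': "(\<lambda>s. \<bar>h0 s\<bar>) absolutely_integrable_on {a..b}"
    using h0 by (rule set_integrable_abs)
  ultimately have "(LINT s|lebesgue. indicator {a..b} s *\<^sub>R \<bar>h0 s\<bar>) = 0"
    using set_lebesgue_integral_eq_integral(2)[OF h0abs'] by (simp add: set_lebesgue_integral_def)
  then have "AE s in lebesgue. indicator {a..b} s *\<^sub>R \<bar>h0 s\<bar> = 0"
    using h0abs' unfolding set_integrable_def by (subst (asm) integral_nonneg_eq_0_iff_AE) auto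
  moreover have "AE s in lebesgue. s \<notin> N"
    using N by (intro AE_not_in) (simp add: negligible_iff_null_sets)
  ultimately show ?thesis
    by eventually_elim (auto simp: h0_def)
qed

section \<open>Integrals against power kernels\<close>

text \<open>
  The identity principle for power series: at a limit point of zeros the leading coefficient
  vanishes, and the series can be divided by \<open>x\<close>.
\<close>

lemma powser_frequently_0_imp_coeff_0:
  fixes c :: "nat \<Rightarrow> real"
  assumes "0 < r" and "\<And>x. \<bar>x\<bar> < r \<Longrightarrow> (\<lambda>n. c n * x ^ n) sums P x"
    and "\<exists>\<^sub>F x in at 0. P x = 0"
  shows "c n = 0"
proof -
  have lead: "c 0 = 0"
    if "\<And>x. \<bar>x\<bar> < r \<Longrightarrow> (\<lambda>n. c n * x ^ n) sums P x" "\<exists>\<^sub>F x in at 0. P x = 0" for c P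
  proof -
    have "(P \<longlongrightarrow> c 0) (at 0)"
      using \<open>0 < r\<close> that(1) by (intro powser_limit_0_strong[of r]) auto
    then show ?thesis
      using that(2) tendsto_imp_eventually_ne frequently_def by metis
  qed
  show ?thesis
    using assms(2,3)
  proof (induction n arbitrary: c P)
    case 0
    then show ?case
      by (rule lead)
  next
    case (Suc n)
    have 0: "c 0 = 0"
      using Suc.prems by (rule lead)
    define Q where "Q x = (if x = 0 then c 1 else P x / x)" for x
    have "c (Suc n) = 0"
    proof (rule Suc.IH[of "\<lambda>n. c (Suc n)" Q])
      show "(\<lambda>n. c (Suc n) * x ^ n) sums Q x" if "\<bar>x\<bar> < r" for x
      proof (cases "x = 0")
        case True
        then show ?thesis using powser_sums_zero[of "\<lambda>n. c (Suc n)"] by (simp add: Q_def)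
      next
        case False
        have "(\<lambda>n. c (Suc n) * x ^ Suc n) sums P x"
          using Suc.prems(1)[OF that] 0 by (subst sums_Suc_iff) simp
        then have "(\<lambda>n. c (Suc n) * x ^ Suc n / x) sums (P x / x)"
          by (rule sums_divide)
        then show ?thesis using False by (simp add: Q_def)
      qed
      have "\<exists>\<^sub>F x in at 0. P x = 0 \<and> x \<noteq> 0"
        using Suc.prems(2) eventually_neq_at_within[of 0 0 UNIV]
        by (rule frequently_eventually_frequently)
      then show "\<exists>\<^sub>F x in at 0. Q x = 0"
        by (rule frequently_elim1) (auto simp: Q_def)
    qed
    then show ?case .
  qed
qed

text \<open>
  With \<open>x = -1/t\<close>, the function \<open>(1 + x s) powr \<gamma>\<close> is the kernel \<open>(t - s) powr \<gamma>\<close> up to the factor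
  \<open>t powr \<gamma>\<close>. Its binomial series converges uniformly for \<open>s \<in> {a..b}\<close>, so that it may be integrated
  term by term, and the moments of \<open>h\<close> appear as coefficients of a power series in \<open>x\<close>.
\<close>

lemma integral_binomial_kernel_sums:
  fixes h :: "real \<Rightarrow> real"
  assumes h: "h absolutely_integrable_on {a..b}"
    and M: "0 < M" "\<And>s. s \<in> {a..b} \<Longrightarrow> \<bar>s\<bar> \<le> M"
    and x: "\<bar>x\<bar> < 1 / M"
  shows "(\<lambda>n. (\<gamma> gchoose n) * integral {a..b} (\<lambda>s. s ^ n * h s) * x ^ n)
           sums integral {a..b} (\<lambda>s. (1 + x * s) powr \<gamma> * h s)"
proof -
  define r where "r = \<bar>x\<bar> * M"
  have r: "0 \<le> r" "r < 1"
    using x M(1) by (auto simp: r_def field_simps)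
  have xs: "\<bar>x * s\<bar> \<le> r" if "s \<in> {a..b}" for s
    using M(2)[OF that] by (auto simp: r_def abs_mult intro!: mult_left_mono)
  \<comment> \<open>The dominating constant \<open>C\<close> below needs absolute convergence at \<open>r\<close>, which follows from
    convergence at the larger point \<open>(1 + r) / 2 < 1\<close>.\<close>
  have "summable (\<lambda>n. (\<gamma> gchoose n) * ((1 + r) / 2) ^ n)"
    using gen_binomial_real[of "(1 + r) / 2" \<gamma>] r sums_summable by auto
  then have "summable (\<lambda>n. norm ((\<gamma> gchoose n) * r ^ n))"
    by (rule powser_insidea) (use r in auto)
  then have summ: "summable (\<lambda>n. \<bar>\<gamma> gchoose n\<bar> * r ^ n)"
    using r by (simp add: abs_mult)
  define C where "C = (\<Sum>n. \<bar>\<gamma> gchoose n\<bar> * r ^ n)"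
  define f where "f k s = (\<Sum>n<k. (\<gamma> gchoose n) * (x * s) ^ n) * h s" for k s
  have pow_int: "(\<lambda>s. s ^ n * h s) integrable_on {a..b}" for n
    by (intro integrable_continuous_mult continuous_intros h)
  have f_eq: "f k = (\<lambda>s. \<Sum>n<k. ((\<gamma> gchoose n) * x ^ n) * (s ^ n * h s))" for k
    by (rule ext) (simp only: f_def sum_distrib_right power_mult_distrib mult.assoc)
  have term_int: "(\<lambda>s. ((\<gamma> gchoose n) * x ^ n) * (s ^ n * h s)) integrable_on {a..b}" for n
    by (intro integrable_on_mult_right pow_int)
  have f_int: "f k integrable_on {a..b}" for k
    unfolding f_eq by (intro integrable_sum term_int) simp
  have f_integral: "integral {a..b} (f k)
      = (\<Sum>n<k. (\<gamma> gchoose n) * integral {a..b} (\<lambda>s. s ^ n * h s) * x ^ n)" for k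
    unfolding f_eq integral_sum[OF finite_lessThan term_int] integral_mult_right
    by (simp add: mult_ac)
  have "(\<lambda>k. integral {a..b} (f k)) \<longlonglongrightarrow> integral {a..b} (\<lambda>s. (1 + x * s) powr \<gamma> * h s)"
  proof (rule dominated_convergence(2)[OF f_int])
    show "(\<lambda>s. C * \<bar>h s\<bar>) integrable_on {a..b}"
      using h by (intro integrable_on_mult_right) (auto simp: absolutely_integrable_on_def)
    show "norm (f k s) \<le> C * \<bar>h s\<bar>" if s: "s \<in> {a..b}" for k s
    proof -
      have "\<bar>\<Sum>n<k. (\<gamma> gchoose n) * (x * s) ^ n\<bar> \<le> (\<Sum>n<k. \<bar>\<gamma> gchoose n\<bar> * r ^ n)"
      proof (rule order_trans[OF sum_abs], rule sum_mono)
        fix n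
        have "\<bar>x * s\<bar> ^ n \<le> r ^ n" by (intro power_mono xs[OF s]) simp
        then show "\<bar>(\<gamma> gchoose n) * (x * s) ^ n\<bar> \<le> \<bar>\<gamma> gchoose n\<bar> * r ^ n"
          unfolding abs_mult[of "\<gamma> gchoose n"] power_abs by (intro mult_left_mono abs_ge_zero)
      qed
      also have "\<dots> \<le> C"
        unfolding C_def by (intro sum_le_suminf summ) (use r in auto)
      finally show ?thesis by (auto simp: f_def abs_mult intro!: mult_right_mono)
    qed
    show "(\<lambda>k. f k s) \<longlonglongrightarrow> (1 + x * s) powr \<gamma> * h s" if s: "s \<in> {a..b}" for s
      using gen_binomial_real[of "x * s" \<gamma>] xs[OF s] r unfolding f_def sums_def
      by (intro tendsto_mult tendsto_const) auto
  qed
  then show ?thesis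
    by (simp add: sums_def f_integral)
qed

lemma gbinomial_neq_0:
  fixes \<gamma> :: real
  assumes "\<gamma> \<notin> \<nat>"
  shows "\<gamma> gchoose n \<noteq> 0"
  using assms by (auto simp: gbinomial_prod_rev)

text \<open>
  The kernels \<open>(t - s) powr \<gamma>\<close> with large \<open>t\<close> determine \<open>h\<close>: as a function of \<open>x = -1/t\<close> the integral is
  a power series with coefficients \<open>(\<gamma> gchoose n)\<close> times the \<open>n\<close>-th moment, and \<open>\<gamma> gchoose n\<close> never
  vanishes when \<open>\<gamma>\<close> is not a natural number. For \<open>\<gamma> \<in> \<nat>\<close> the kernel is a polynomial in \<open>s\<close> and only
  finitely many moments are seen.
\<close>

lemma AE_eq_0_if_power_kernel_integral_eq_0:
  fixes h :: "real \<Rightarrow> real"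
  assumes h: "h absolutely_integrable_on {a..b}"
    and \<gamma>: "\<gamma> \<notin> \<nat>"
    and zero: "\<exists>\<^sub>F t in at_top. integral {a..b} (\<lambda>s. (t - s) powr \<gamma> * h s) = 0"
  shows "AE s in lebesgue. s \<in> {a..b} \<longrightarrow> h s = 0"
proof -
  define M where "M = max 1 (max \<bar>a\<bar> \<bar>b\<bar>)"
  have M: "0 < M" "\<And>s. s \<in> {a..b} \<Longrightarrow> \<bar>s\<bar> \<le> M"
    by (auto simp: M_def)
  define P where "P x = integral {a..b} (\<lambda>s. (1 + x * s) powr \<gamma> * h s)" for x
  have scale: "integral {a..b} (\<lambda>s. (t - s) powr \<gamma> * h s) = t powr \<gamma> * P (- 1 / t)" if "t > M" for t
  proof -
    have "(t - s) powr \<gamma> * h s = t powr \<gamma> * ((1 + (- 1 / t) * s) powr \<gamma> * h s)" if "s \<in> {a..b}" for s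
    proof -
      have "t - s = t * (1 + (- 1 / t) * s)" and "0 \<le> 1 + (- 1 / t) * s"
        using \<open>t > M\<close> M(1) M(2)[OF that] by (auto simp: field_simps)
      then show ?thesis
        using \<open>t > M\<close> M(1) by (simp only: powr_mult mult.assoc)
    qed
    then have "integral {a..b} (\<lambda>s. (t - s) powr \<gamma> * h s)
        = integral {a..b} (\<lambda>s. t powr \<gamma> * ((1 + (- 1 / t) * s) powr \<gamma> * h s))"
      by (rule integral_cong)
    then show ?thesis by (simp add: P_def)
  qed
  have P0: "\<exists>\<^sub>F x in at 0. P x = 0"
  proof (rule ccontr)
    assume "\<not> (\<exists>\<^sub>F x in at 0. P x = 0)"
    then have "\<forall>\<^sub>F x in at 0. P x \<noteq> 0"
      by (simp add: not_frequently)
    moreover have "filterlim (\<lambda>t::real. - 1 / t) (at 0) at_top"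
    proof (rule filterlim_atI)
      show "((\<lambda>t::real. - 1 / t) \<longlongrightarrow> 0) at_top"
        by (intro tendsto_divide_0[OF tendsto_const] filterlim_at_top_imp_at_infinity filterlim_ident)
      show "\<forall>\<^sub>F t::real in at_top. - 1 / t \<noteq> 0"
        using eventually_gt_at_top[of 0] by eventually_elim auto
    qed
    ultimately have "\<forall>\<^sub>F t in at_top. P (- 1 / t) \<noteq> 0"
      by (rule eventually_compose_filterlim)
    then have "\<forall>\<^sub>F t in at_top. integral {a..b} (\<lambda>s. (t - s) powr \<gamma> * h s) \<noteq> 0"
      using eventually_gt_at_top[of M] by eventually_elim (use M(1) in \<open>auto simp: scale\<close>)
    with zero show False by (simp add: frequently_def)
  qed
  have "(\<gamma> gchoose n) * integral {a..b} (\<lambda>s. s ^ n * h s) = 0" for n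
  proof (rule powser_frequently_0_imp_coeff_0[OF _ _ P0])
    show "0 < 1 / M" using M(1) by simp
  qed (unfold P_def, rule integral_binomial_kernel_sums[OF h M])
  then show ?thesis
    using gbinomial_neq_0[OF \<gamma>] by (intro AE_eq_0_if_moments_eq_0 h) auto
qed

lemma absolutely_integrable_power_kernel:
  fixes h :: "real \<Rightarrow> real"
  assumes "h absolutely_integrable_on {a..b}" and "b < t"
  shows "(\<lambda>s. (t - s) powr \<gamma> * h s) absolutely_integrable_on {a..b}"
proof (rule absolutely_integrable_continuous_mult[OF _ assms(1)])
  show "continuous_on {a..b} (\<lambda>s. (t - s) powr \<gamma>)"
    using assms(2) by (intro continuous_on_powr continuous_intros) auto
qed

text \<open>
  Differentiation under the integral sign: the difference quotients of the kernel at a point \<open>t > b\<close>,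
  which stays away from the singularity, are bounded by the mean value theorem.
\<close>

lemma has_real_derivative_power_kernel_integral:
  fixes h :: "real \<Rightarrow> real"
  assumes h: "h absolutely_integrable_on {a..b}" and "b < t"
  shows "((\<lambda>t. integral {a..b} (\<lambda>s. (t - s) powr \<gamma> * h s)) has_real_derivative
           \<gamma> * integral {a..b} (\<lambda>s. (t - s) powr (\<gamma> - 1) * h s)) (at t)"
proof -
  define F where "F t = integral {a..b} (\<lambda>s. (t - s) powr \<gamma> * h s)" for t
  define d where "d = (t - b) / 2"
  have d: "0 < d" "b = t - 2 * d" using \<open>b < t\<close> by (auto simp: d_def field_simps)
  define U where "U = {t - d<..<t + d}"
  \<comment> \<open>All values \<open>y - s\<close> with \<open>y\<close> near \<open>t\<close> and \<open>s \<in> {a..b}\<close> lie in this compact subset of \<open>{0<..}\<close>.\<close>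
  define Z where "Z = {d..t + d - a}"
  have Z: "y - s \<in> Z" if "y \<in> U" "s \<in> {a..b}" for y s
    using that d by (auto simp: U_def Z_def)
  have "continuous_on Z (\<lambda>z. \<gamma> * z powr (\<gamma> - 1))"
    using d by (intro continuous_on_mult continuous_on_powr continuous_intros) (auto simp: Z_def)
  then have "bounded ((\<lambda>z. \<gamma> * z powr (\<gamma> - 1)) ` Z)"
    by (intro compact_imp_bounded compact_continuous_image) (auto simp: Z_def)
  then obtain B where B: "\<And>z. z \<in> Z \<Longrightarrow> norm (\<gamma> * z powr (\<gamma> - 1)) \<le> B"
    by (auto simp: bounded_iff)
  have deriv: "((\<lambda>z. z powr \<gamma>) has_real_derivative \<gamma> * z powr (\<gamma> - 1)) (at z)" if "z \<in> Z" for z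
    using that d by (auto simp: Z_def intro!: has_real_derivative_powr)
  have lip: "\<bar>z powr \<gamma> - w powr \<gamma>\<bar> \<le> B * \<bar>z - w\<bar>" if "z \<in> Z" "w \<in> Z" for z w
    using field_differentiable_bound[of Z "\<lambda>z. z powr \<gamma>" "\<lambda>z. \<gamma> * z powr (\<gamma> - 1)" B z w]
      deriv[THEN DERIV_subset] B that by (auto simp: Z_def)
  have int: "(\<lambda>s. (y - s) powr \<gamma> * h s) integrable_on {a..b}" if "y \<in> U" for y
    using that d by (intro set_lebesgue_integral_eq_integral(1) absolutely_integrable_power_kernel[OF h])
      (auto simp: U_def)
  have tU: "t \<in> U" using d by (simp add: U_def)
  have "((\<lambda>y. (F y - F t) / (y - t)) \<longlongrightarrow> integral {a..b} (\<lambda>s. \<gamma> * (t - s) powr (\<gamma> - 1) * h s)) (at t within U)"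
    unfolding tendsto_at_iff_sequentially
  proof (intro allI impI)
    fix X :: "nat \<Rightarrow> real"
    assume XU: "\<forall>i. X i \<in> U - {t}" and X: "X \<longlonglongrightarrow> t"
    define q where "q i s = ((X i - s) powr \<gamma> - (t - s) powr \<gamma>) / (X i - t) * h s" for i s
    have q_eq: "q i = (\<lambda>s. inverse (X i - t) * ((X i - s) powr \<gamma> * h s - (t - s) powr \<gamma> * h s))" for i
      by (auto simp: q_def fun_eq_iff field_simps)
    have q_int: "q i integrable_on {a..b}" for i
      unfolding q_eq using XU tU by (intro integrable_on_mult_right integrable_diff int) auto
    have q_integral: "integral {a..b} (q i) = (F (X i) - F t) / (X i - t)" for i
      unfolding q_eq F_def using XU tU int by (simp add: integral_diff field_simps)
    have "(\<lambda>i. integral {a..b} (q i)) \<longlonglongrightarrow> integral {a..b} (\<lambda>s. \<gamma> * (t - s) powr (\<gamma> - 1) * h s)"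
    proof (rule dominated_convergence(2)[OF q_int])
      show "(\<lambda>s. B * \<bar>h s\<bar>) integrable_on {a..b}"
        using h by (intro integrable_on_mult_right) (auto simp: absolutely_integrable_on_def)
      show "norm (q i s) \<le> B * \<bar>h s\<bar>" if s: "s \<in> {a..b}" for i s
      proof -
        have Xi: "X i \<in> U" "X i \<noteq> t" using XU by auto
        have "\<bar>(X i - s) powr \<gamma> - (t - s) powr \<gamma>\<bar> \<le> B * \<bar>X i - t\<bar>"
          using lip[OF Z[OF Xi(1) s] Z[OF tU s]] by simp
        then have "\<bar>((X i - s) powr \<gamma> - (t - s) powr \<gamma>) / (X i - t)\<bar> \<le> B"
          using Xi by (simp add: abs_divide divide_le_eq)
        then show ?thesis
          unfolding q_def real_norm_def abs_mult[of _ "h s"] by (intro mult_right_mono abs_ge_zero)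
      qed
      show "(\<lambda>i. q i s) \<longlonglongrightarrow> \<gamma> * (t - s) powr (\<gamma> - 1) * h s" if s: "s \<in> {a..b}" for s
      proof -
        have "((\<lambda>z. z powr \<gamma>) has_real_derivative \<gamma> * (t - s) powr (\<gamma> - 1)) (at (t + - s))"
          using deriv[OF Z[OF tU s]] by simp
        then have "((\<lambda>y. (y + - s) powr \<gamma>) has_real_derivative \<gamma> * (t - s) powr (\<gamma> - 1)) (at t)"
          by (simp only: DERIV_shift)
        then have "((\<lambda>y. (y - s) powr \<gamma>) has_real_derivative \<gamma> * (t - s) powr (\<gamma> - 1)) (at t within U)"
          by (simp add: has_field_derivative_at_within)
        then have "((\<lambda>y. ((y - s) powr \<gamma> - (t - s) powr \<gamma>) / (y - t))
            \<longlongrightarrow> \<gamma> * (t - s) powr (\<gamma> - 1)) (at t within U)"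
          by (simp add: has_field_derivative_iff)
        then have "(\<lambda>i. ((X i - s) powr \<gamma> - (t - s) powr \<gamma>) / (X i - t))
            \<longlonglongrightarrow> \<gamma> * (t - s) powr (\<gamma> - 1)"
          unfolding tendsto_at_iff_sequentially using XU X by (auto simp: o_def)
        then show ?thesis unfolding q_def by (intro tendsto_mult tendsto_const)
      qed
    qed
    then show "((\<lambda>y. (F y - F t) / (y - t)) \<circ> X)
        \<longlonglongrightarrow> integral {a..b} (\<lambda>s. \<gamma> * (t - s) powr (\<gamma> - 1) * h s)"
      by (simp add: q_integral o_def)
  qed
  moreover have "at t within U = at t"
    using tU by (intro at_within_open) (auto simp: U_def)
  ultimately show ?thesis
    by (simp add: has_field_derivative_iff F_def mult.assoc)
qed

section \<open>Almost everywhere properties of periodic functions\<close>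

lemma AE_lebesgue_shift:
  fixes P :: "real \<Rightarrow> bool"
  assumes "AE t in lebesgue. P t"
  shows "AE t in lebesgue. P (t + c)"
proof -
  obtain N where N: "negligible N" "{t. \<not> P t} \<subseteq> N"
    using assms unfolding eventually_ae_filter_negligible by blast
  have "{t. \<not> P (t + c)} \<subseteq> (+) (- c) ` N"
    using N(2) by (force simp: image_iff)
  then show ?thesis
    unfolding eventually_ae_filter_negligible using negligible_translation[OF N(1)] by blast
qed

lemma AE_lebesgue_exists_between:
  fixes u v :: real
  assumes "AE t in lebesgue. P t" and "u < v"
  shows "\<exists>t\<in>{u<..<v}. P t"
proof (rule ccontr)
  assume "\<not> ?thesis"
  moreover obtain N where N: "negligible N" "{t. \<not> P t} \<subseteq> N"
    using assms unfolding eventually_ae_filter_negligible by blast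
  ultimately have "negligible {u<..<v}"
    by (intro negligible_subset[OF N(1)]) auto
  then show False
    using open_not_negligible[of "{u<..<v}"] \<open>u < v\<close> by simp
qed

lemma AE_imp_frequently_at_top:
  assumes "AE t in lebesgue. (0::real) < t \<longrightarrow> P t"
  shows "\<exists>\<^sub>F t in at_top. P t"
proof -
  have "\<exists>t>N. P t" for N
    using AE_lebesgue_exists_between[OF assms, of "max N 0" "max N 0 + 1"] by auto
  then show ?thesis
    by (fastforce simp: frequently_def eventually_at_top_dense)
qed

lemma AE_lebesgue_if_AE_period:
  fixes P :: "real \<Rightarrow> bool"
  assumes "0 < T" and per: "periodic_fun_simple P T"
    and AE: "AE t in lebesgue. t \<in> {a..a + T} \<longrightarrow> P t"
  shows "AE t in lebesgue. P t"
proof -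
  interpret periodic_fun_simple P T by (rule per)
  have "AE t in lebesgue. \<forall>k::int. t + of_int k * T \<in> {a..a + T} \<longrightarrow> P (t + of_int k * T)"
    unfolding AE_all_countable using AE_lebesgue_shift[OF AE] by blast
  then show ?thesis
  proof eventually_elim
    fix t assume *: "\<forall>k::int. t + of_int k * T \<in> {a..a + T} \<longrightarrow> P (t + of_int k * T)"
    \<comment> \<open>The translate of \<open>t\<close> by \<open>k\<close> periods falls into the given period interval.\<close>
    define k where "k = - \<lfloor>(t - a) / T\<rfloor>"
    have "of_int (- k) \<le> (t - a) / T" "(t - a) / T \<le> of_int (- k) + 1"
      unfolding k_def by linarith+
    then have "t + of_int k * T \<in> {a..a + T}"
      using \<open>0 < T\<close> by (simp add: field_simps)
    with * have "P (t + of_int k * T)" by blast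
    then show "P t" by (simp add: plus_of_int)
  qed
qed

section \<open>Fractional operators on periodic functions\<close>

lemma absolutely_integrable_on_shift_real:
  fixes f :: "real \<Rightarrow> real"
  shows "(\<lambda>x. f (x + c)) absolutely_integrable_on {a - c..b - c} \<longleftrightarrow> f absolutely_integrable_on {a..b}"
  unfolding absolutely_integrable_on_def
  using integrable_shift_real_ivl_iff[of f c a b] integrable_shift_real_ivl_iff[of "\<lambda>x. norm (f x)" c a b]
  by simp

text \<open>
  Moving the variable of integration by one period turns the integral over \<open>{0..t + T}\<close> into one over
  \<open>{- T..t}\<close>. So passing from \<open>t\<close> to \<open>t + T\<close> adds only the part of the memory that comes from the extra
  period \<open>{- T..0}\<close>, which is a nonsingular integral because \<open>t > 0\<close>.
\<close>

lemma frac_int_shift_period: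
  assumes T: "0 < T" and per: "\<And>s. g (s + T) = g s"
    and g: "g absolutely_integrable_on {- T..0}"
    and t: "0 < t" and ex: "frac_int_exists \<beta> g t"
  shows "frac_int \<beta> g (t + T)
       = frac_int \<beta> g t + 1 / Gamma \<beta> * integral {- T..0} (\<lambda>s. (t - s) powr (\<beta> - 1) * g s)"
proof -
  define k where "k s = (t - s) powr (\<beta> - 1) * g s" for s
  define k' where "k' s = (t + T - s) powr (\<beta> - 1) * g s" for s
  have k': "k' (s + T) = k s" for s
    by (simp add: k_def k'_def per)
  have k1: "k absolutely_integrable_on {- T..0}"
    unfolding k_def by (rule absolutely_integrable_power_kernel[OF g t])
  have k2: "k absolutely_integrable_on {0..t}"
    using ex by (simp add: frac_int_exists_def k_def[abs_def])
  have k3: "k absolutely_integrable_on {- T..t}"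
    by (rule absolutely_integrable_on_combine[OF k1 k2]) (use T t in auto)
  have k'1: "k' absolutely_integrable_on {0..t + T}"
    using k3 absolutely_integrable_on_shift_real[of 0 T "t + T" k'] by (simp add: k')
  have "(LINT s:{0..t + T}|lebesgue. k' s) = integral {0..t + T} k'"
    by (rule set_lebesgue_integral_eq_integral(2)[OF k'1])
  also have "\<dots> = integral {- T..t} k"
    using integral_shift_real_ivl[of 0 T "t + T" k'] by (simp add: k')
  also have "\<dots> = integral {- T..0} k + integral {0..t} k"
    using T t set_lebesgue_integral_eq_integral(1)[OF k3]
    by (intro Henstock_Kurzweil_Integration.integral_combine[symmetric]) auto
  also have "integral {0..t} k = (LINT s:{0..t}|lebesgue. k s)"
    by (rule set_lebesgue_integral_eq_integral(2)[OF k2, symmetric])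
  finally show ?thesis
    by (simp add: frac_int_def k_def k'_def algebra_simps)
qed

lemma AE_eq_0_if_frac_int_periodic:
  assumes T: "0 < T" and per: "periodic_fun_simple g T"
    and g: "g absolutely_integrable_on {- T..0}"
    and \<beta>: "0 < \<beta>" "\<beta> < 1"
    and frac: "ae_periodic (frac_int_exists \<beta> g) (frac_int \<beta> g) T"
  shows "AE s in lebesgue. g s = 0"
proof -
  interpret periodic_fun_simple g T by (rule per)
  have "AE t in lebesgue. 0 < t \<longrightarrow> frac_int_exists \<beta> g t"
    and "AE t in lebesgue. 0 < t \<longrightarrow> frac_int \<beta> g (t + T) = frac_int \<beta> g t"
    using frac by (auto simp: ae_periodic_def)
  then have "AE t in lebesgue. 0 < t \<longrightarrow> integral {- T..0} (\<lambda>s. (t - s) powr (\<beta> - 1) * g s) = 0"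
  proof eventually_elim
    case (elim t)
    then show ?case
      using frac_int_shift_period[OF T plus_period g, of t \<beta>] Gamma_real_pos[OF \<beta>(1)] by auto
  qed
  then have "\<exists>\<^sub>F t in at_top. integral {- T..0} (\<lambda>s. (t - s) powr (\<beta> - 1) * g s) = 0"
    by (rule AE_imp_frequently_at_top)
  moreover have "\<beta> - 1 \<notin> \<nat>"
    using \<beta> by (auto simp: Nats_def)
  ultimately have "AE s in lebesgue. s \<in> {- T..- T + T} \<longrightarrow> g s = 0"
    using AE_eq_0_if_power_kernel_integral_eq_0[OF g] by simp
  moreover have "periodic_fun_simple (\<lambda>s. g s = 0) T"
    by (rule periodic_fun_simple.intro) (simp add: plus_period)
  ultimately show ?thesis
    using AE_lebesgue_if_AE_period[OF T] by blast
qed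

text \<open>
  Write \<open>J = frac_int (1 - \<alpha>) f\<close> and \<open>K t = J (t + T) - J t\<close>. Equality of the derivatives of \<open>J\<close> at
  \<open>t + T\<close> and \<open>t\<close> means \<open>K' t = 0\<close>. As \<open>J\<close> is differentiable only almost everywhere, it cannot be
  integrated back to \<open>K\<close> being constant; instead \<open>K'\<close> is itself an integral against a power kernel,
  with exponent \<open>- \<alpha> - 1\<close>, and its zeros suffice.
\<close>

lemma AE_eq_0_if_rl_periodic:
  assumes T: "0 < T" and per: "periodic_fun_simple f T"
    and f: "f absolutely_integrable_on {- T..0}"
    and \<alpha>: "0 < \<alpha>" "\<alpha> < 1"
    and rl: "rl_periodic \<alpha> f T"
  shows "AE s in lebesgue. f s = 0"
proof -
  interpret periodic_fun_simple f T by (rule per)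
  define J where "J = frac_int (1 - \<alpha>) f"
  define K where "K t = 1 / Gamma (1 - \<alpha>) * integral {- T..0} (\<lambda>s. (t - s) powr (- \<alpha>) * f s)" for t
  define S where "S = {t. 0 < t \<and> rl_deriv_exists \<alpha> f t}"
  have \<Gamma>: "Gamma (1 - \<alpha>) > 0"
    using \<alpha> by (intro Gamma_real_pos) simp
  have JK: "J (t + T) - J t = K t" if "t \<in> S" for t
    using frac_int_shift_period[OF T plus_period f, of t "1 - \<alpha>"] that
    by (simp add: S_def rl_deriv_exists_def J_def K_def)
  have ex: "AE t in lebesgue. 0 < t \<longrightarrow> rl_deriv_exists \<alpha> f t"
    and eq: "AE t in lebesgue. 0 < t \<longrightarrow> rl_deriv \<alpha> f (t + T) = rl_deriv \<alpha> f t"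
    using rl by (auto simp: rl_periodic_def ae_periodic_def)
  have "AE t in lebesgue. 0 < t \<longrightarrow> integral {- T..0} (\<lambda>s. (t - s) powr (- \<alpha> - 1) * f s) = 0"
    using ex AE_lebesgue_shift[OF ex, of T] eq
  proof eventually_elim
    case (elim t)
    show ?case
    proof
      assume "0 < t"
      then have t: "t \<in> S" "rl_deriv_exists \<alpha> f (t + T)" "deriv J (t + T) = deriv J t"
        using elim T by (auto simp: S_def rl_deriv_def J_def)
      have "(J has_real_derivative deriv J t) (at t)" "(J has_real_derivative deriv J t) (at (t + T))"
        using t DERIV_deriv_iff_real_differentiable unfolding S_def rl_deriv_exists_def J_def
        by (metis mem_Collect_eq)+
      then have "((\<lambda>u. J (u + T) - J u) has_real_derivative deriv J t - deriv J t) (at t)"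
        by (intro DERIV_diff) (simp_all add: DERIV_shift)
      then have "((\<lambda>u. J (u + T) - J u) has_real_derivative 0) (at t within S)"
        by (simp add: has_field_derivative_at_within)
      then have K0: "(K has_real_derivative 0) (at t within S)"
        unfolding has_field_derivative_def using t(1) JK
        by (elim has_derivative_transform[rotated 2]) auto
      have "(K has_real_derivative 1 / Gamma (1 - \<alpha>) *
          (- \<alpha> * integral {- T..0} (\<lambda>s. (t - s) powr (- \<alpha> - 1) * f s))) (at t)"
        unfolding K_def by (intro DERIV_cmult has_real_derivative_power_kernel_integral f \<open>0 < t\<close>)
      then have K1: "(K has_real_derivative 1 / Gamma (1 - \<alpha>) *
          (- \<alpha> * integral {- T..0} (\<lambda>s. (t - s) powr (- \<alpha> - 1) * f s))) (at t within S)"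
        by (rule has_field_derivative_at_within)
      \<comment> \<open>Both derivatives are taken within \<open>S\<close>, since only there \<open>J (u + T) - J u\<close> is known to be \<open>K u\<close>.
        They agree because \<open>S\<close> has full measure and so accumulates at \<open>t\<close>.\<close>
      have "t islimpt S"
        unfolding islimpt_approachable
      proof (intro allI impI)
        fix e :: real assume "0 < e"
        then obtain u where "u \<in> {t<..<t + e}" "0 < u \<longrightarrow> rl_deriv_exists \<alpha> f u"
          using AE_lebesgue_exists_between[OF ex, of t "t + e"] by auto
        then show "\<exists>u\<in>S. u \<noteq> t \<and> dist u t < e"
          using \<open>0 < t\<close> by (intro bexI[of _ u]) (auto simp: S_def dist_real_def)
      qed
      then have "at t within S \<noteq> bot"
        by (simp add: trivial_limit_within)
      then have "1 / Gamma (1 - \<alpha>) * (- \<alpha> * integral {- T..0} (\<lambda>s. (t - s) powr (- \<alpha> - 1) * f s)) = 0"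
        using K0 K1 vector_derivative_unique_within
        unfolding has_real_derivative_iff_has_vector_derivative by blast
      then show "integral {- T..0} (\<lambda>s. (t - s) powr (- \<alpha> - 1) * f s) = 0"
        using \<Gamma> \<alpha> by simp
    qed
  qed
  then have "\<exists>\<^sub>F t in at_top. integral {- T..0} (\<lambda>s. (t - s) powr (- \<alpha> - 1) * f s) = 0"
    by (rule AE_imp_frequently_at_top)
  moreover have "- \<alpha> - 1 \<notin> \<nat>"
    using \<alpha> by (auto simp: Nats_def)
  ultimately have "AE s in lebesgue. s \<in> {- T..- T + T} \<longrightarrow> f s = 0"
    using AE_eq_0_if_power_kernel_integral_eq_0[OF f] by simp
  moreover have "periodic_fun_simple (\<lambda>s. f s = 0) T"
    by (rule periodic_fun_simple.intro) (simp add: plus_period)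
  ultimately show ?thesis
    using AE_lebesgue_if_AE_period[OF T] by blast
qed

text \<open>
  The kernel can be divided out, since its reciprocal \<open>(t - s) powr (1 - \<beta>)\<close> is continuous on \<open>{0..t}\<close>.
  This provides the integrability of \<open>deriv f\<close>, which is not a consequence of that of \<open>f\<close>.
\<close>

lemma absolutely_integrable_if_frac_int_exists:
  fixes g :: "real \<Rightarrow> real"
  assumes "frac_int_exists \<beta> g t" and "\<beta> < 1"
  shows "g absolutely_integrable_on {0..t}"
proof -
  have k: "(\<lambda>s. (t - s) powr (\<beta> - 1) * g s) absolutely_integrable_on {0..t}"
    using assms by (simp add: frac_int_exists_def)
  have "continuous_on {0..t} (\<lambda>s. (t - s) powr (1 - \<beta>))"
    using assms(2) by (intro continuous_on_powr' continuous_intros) auto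
  then have "(\<lambda>s. (t - s) powr (1 - \<beta>) * ((t - s) powr (\<beta> - 1) * g s)) absolutely_integrable_on {0..t}"
    using k by (rule absolutely_integrable_continuous_mult)
  then show ?thesis
  proof (rule absolutely_integrable_spike[where S = "{t}"])
    fix s assume "s \<in> {0..t} - {t}"
    then have "(t - s) powr (1 - \<beta>) * (t - s) powr (\<beta> - 1) = 1"
      by (simp flip: powr_add)
    then show "g s = (t - s) powr (1 - \<beta>) * ((t - s) powr (\<beta> - 1) * g s)"
      by (simp flip: mult.assoc)
  qed auto
qed

text \<open>
  The Caputo derivative is a fractional integral of the periodic function \<open>deriv f\<close>. Because
  \<open>deriv f s = 0\<close> says nothing where \<open>f\<close> is not differentiable, the differentiability almost
  everywhere on \<open>{0<..}\<close> is carried over to the whole line by periodicity.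
\<close>

lemma AE_deriv_0_if_caputo_periodic:
  assumes T: "0 < T" and per: "periodic_fun_simple f T"
    and \<alpha>: "0 < \<alpha>" "\<alpha> < 1"
    and caputo: "caputo_periodic \<alpha> f T"
  shows "AE t in lebesgue. (f has_real_derivative 0) (at t)"
proof -
  interpret periodic_fun_simple f T by (rule per)
  have shift: "(f has_real_derivative D) (at (t + T)) \<longleftrightarrow> (f has_real_derivative D) (at t)" for D t
    by (simp add: DERIV_shift plus_period)
  have deriv_per: "periodic_fun_simple (deriv f) T"
    by (rule periodic_fun_simple.intro) (simp add: deriv_def shift)
  have diff_per: "periodic_fun_simple (\<lambda>t. f differentiable (at t)) T"
    by (rule periodic_fun_simple.intro) (simp add: real_differentiable_def shift)
  have ex: "AE t in lebesgue. 0 < t \<longrightarrow> caputo_deriv_exists \<alpha> f t"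
    using caputo by (simp add: caputo_periodic_def ae_periodic_def)
  obtain t where t: "T < t" "caputo_deriv_exists \<alpha> f t"
    using AE_lebesgue_exists_between[OF ex, of T "T + 1"] T by auto
  have "deriv f absolutely_integrable_on {0..t}"
    using t \<alpha> absolutely_integrable_if_frac_int_exists[of "1 - \<alpha>" "deriv f" t]
    by (simp add: caputo_deriv_exists_def)
  then have "deriv f absolutely_integrable_on {0..T}"
    by (rule absolutely_integrable_on_subinterval) (use t in auto)
  then have "deriv f absolutely_integrable_on {- T..0}"
    using absolutely_integrable_on_shift_real[of 0 T T "deriv f"] periodic_fun_simple.plus_period[OF deriv_per]
    by simp
  moreover have "ae_periodic (frac_int_exists (1 - \<alpha>) (deriv f)) (frac_int (1 - \<alpha>) (deriv f)) T"
    using caputo by (auto simp: caputo_periodic_def ae_periodic_def caputo_deriv_exists_def caputo_deriv_def[abs_def])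
  ultimately have "AE s in lebesgue. deriv f s = 0"
    using \<alpha> by (intro AE_eq_0_if_frac_int_periodic[OF T deriv_per]) auto
  moreover have "AE s in lebesgue. f differentiable (at s)"
  proof (rule AE_lebesgue_if_AE_period[OF T diff_per])
    have "AE s in lebesgue. 0 < s \<and> s < t \<longrightarrow> f differentiable (at s)"
      using t by (simp add: caputo_deriv_exists_def)
    moreover have "AE s in lebesgue. s \<noteq> (0::real)"
      using AE_not_in[of "{0::real}" lebesgue] by (simp flip: negligible_iff_null_sets)
    ultimately show "AE s in lebesgue. s \<in> {0..0 + T} \<longrightarrow> f differentiable (at s)"
      by eventually_elim (use t in auto)
  qed
  ultimately show ?thesis
    by eventually_elim (metis DERIV_deriv_iff_real_differentiable)
qed

section \<open>Absolutely continuous functions with vanishing derivative\<close>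

text \<open>
  The increment over \<open>{a..b}\<close> is summed over a tagged division. Intervals tagged at points with
  derivative \<open>0\<close> contribute little relative to their length; intervals tagged in the exceptional
  null set lie in an open set of small measure, so absolute continuity bounds their contribution.
\<close>

lemma absolutely_continuous_AE_deriv_0_imp_eq:
  fixes f :: "real \<Rightarrow> real"
  assumes ac: "absolutely_continuous_on a b f" and "a \<le> b"
    and deriv: "AE t in lebesgue. (f has_real_derivative 0) (at t)"
  shows "f b = f a"
proof -
  obtain N where N: "negligible N" "\<And>t. t \<notin> N \<Longrightarrow> (f has_real_derivative 0) (at t)"
    using deriv unfolding eventually_ae_filter_negligible by blast
  have bound: "\<bar>f b - f a\<bar> \<le> \<epsilon> * (1 + (b - a))" if "\<epsilon> > 0" for \<epsilon>
  proof -
    obtain \<delta> where "\<delta> > 0" and \<delta>: "\<And>(n::nat) x y.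
        \<lbrakk>\<And>i. i < n \<Longrightarrow> a \<le> x i \<and> x i \<le> y i \<and> y i \<le> b;
         disjoint_family_on (\<lambda>i. {x i<..<y i}) {..<n}; (\<Sum>i<n. y i - x i) < \<delta>\<rbrakk>
        \<Longrightarrow> (\<Sum>i<n. \<bar>f (y i) - f (x i)\<bar>) < \<epsilon>"
      using ac \<open>\<epsilon> > 0\<close> unfolding absolutely_continuous_on_def by meson
    obtain U where U: "open U" "N \<subseteq> U" "U - N \<in> lmeasurable" "emeasure lebesgue (U - N) < ennreal \<delta>"
      using sets_lebesgue_outer_open[OF negligible_imp_sets[OF N(1)] \<open>\<delta> > 0\<close>] .
    have "U - N \<union> N \<in> lmeasurable"
      by (rule fmeasurable.Un[OF U(3) negligible_imp_measurable[OF N(1)]])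
    then have Um: "U \<in> lmeasurable"
      using U(2) by (simp add: Un_absorb2)
    have "measure lebesgue U = measure lebesgue (U - N)"
      by (intro measure_negligible_symdiff[symmetric] Um negligible_subset[OF N(1)]) auto
    also have "\<dots> < \<delta>"
      using U(3,4) \<open>\<delta> > 0\<close> by (simp add: emeasure_eq_measure2 ennreal_less_iff)
    finally have U_small: "measure lebesgue U < \<delta>" .

    have "\<exists>d>0. \<forall>y. \<bar>y - x\<bar> < d \<longrightarrow> \<bar>f y - f x\<bar> \<le> \<epsilon> * \<bar>y - x\<bar>" if "x \<notin> N" for x
      using N(2)[OF that] \<open>\<epsilon> > 0\<close>
      by (auto simp: has_field_derivative_def has_derivative_at_alt)
    then obtain d where d: "\<And>x. x \<notin> N \<Longrightarrow> 0 < d x"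
      "\<And>x y. \<lbrakk>x \<notin> N; \<bar>y - x\<bar> < d x\<rbrakk> \<Longrightarrow> \<bar>f y - f x\<bar> \<le> \<epsilon> * \<bar>y - x\<bar>"
      by metis
    define G where "G x = (if x \<in> N then U else ball x (d x))" for x
    have "gauge G"
      using U d(1) by (auto simp: gauge_def G_def)
    then obtain p where p: "p tagged_division_of {a..b}" and fine: "G fine p"
      by (rule fine_division_exists_real)
    note pD = tagged_division_ofD[OF p]
    define l r where "l K = Inf K" and "r K = Sup K" for K :: "real set"
    have K: "interior K = {l K<..<r K}" "l K \<le> x" "x \<le> r K" "a \<le> l K" "r K \<le> b" "l K \<in> K" "r K \<in> K" "K \<subseteq> G x"
      if xK: "(x, K) \<in> p" for x K
    proof -
      obtain u v where uv: "K = {u..v}" using pD(4)[OF xK] by auto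
      moreover have "x \<in> K" "K \<subseteq> {a..b}" using pD(2,3)[OF xK] by auto
      ultimately show "interior K = {l K<..<r K}" "l K \<le> x" "x \<le> r K" "a \<le> l K" "r K \<le> b" "l K \<in> K" "r K \<in> K"
        by (auto simp: l_def r_def)
      show "K \<subseteq> G x" using fine xK by (auto simp: fine_def)
    qed
    define p1 p2 where "p1 = {(x, K) \<in> p. x \<in> N}" and "p2 = {(x, K) \<in> p. x \<notin> N}"
    have p12: "p = p1 \<union> p2" "p1 \<inter> p2 = {}" "finite p1" "finite p2"
      by (auto simp: p1_def p2_def intro!: finite_subset[OF _ pD(1)])
    have split: "sum \<phi> p = sum \<phi> p1 + sum \<phi> p2" for \<phi> :: "real \<times> real set \<Rightarrow> real"
      unfolding p12(1) using p12(2-4) by (intro sum.union_disjoint)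
    have "f b - f a = (\<Sum>(x, K)\<in>p. f (r K) - f (l K))"
      using additive_tagged_division_1[OF \<open>a \<le> b\<close> p, of f] by (simp add: l_def r_def)
    then have total: "\<bar>f b - f a\<bar>
        \<le> (\<Sum>(x, K)\<in>p1. \<bar>f (r K) - f (l K)\<bar>) + (\<Sum>(x, K)\<in>p2. \<bar>f (r K) - f (l K)\<bar>)"
      using sum_abs[of "\<lambda>(x, K). f (r K) - f (l K)" p]
      by (simp add: split case_prod_unfold)

    have "(\<Sum>(x, K)\<in>p2. \<bar>f (r K) - f (l K)\<bar>) \<le> (\<Sum>(x, K)\<in>p2. \<epsilon> * (r K - l K))"
    proof (rule sum_mono, clarify)
      fix x K assume "(x, K) \<in> p2"
      then have xK: "(x, K) \<in> p" "x \<notin> N" by (auto simp: p2_def)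
      have "\<bar>l K - x\<bar> < d x" "\<bar>r K - x\<bar> < d x"
        using K(6-8)[OF xK(1)] xK(2) by (auto simp: G_def dist_real_def)
      then have "\<bar>f (l K) - f x\<bar> \<le> \<epsilon> * (x - l K)" "\<bar>f (r K) - f x\<bar> \<le> \<epsilon> * (r K - x)"
        using d(2)[OF xK(2), of "l K"] d(2)[OF xK(2), of "r K"] K(2,3)[OF xK(1)] by auto
      then show "\<bar>f (r K) - f (l K)\<bar> \<le> \<epsilon> * (r K - l K)"
        by (simp add: right_diff_distrib)
    qed
    also have "\<dots> \<le> (\<Sum>(x, K)\<in>p. \<epsilon> * (r K - l K))"
      using \<open>\<epsilon> > 0\<close> K(2,3) by (intro sum_mono2 pD(1)) (force simp: p2_def)+
    also have "\<dots> = \<epsilon> * (b - a)"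
      using additive_tagged_division_1[OF \<open>a \<le> b\<close> p, of "\<lambda>x. x"]
      by (simp add: l_def r_def case_prod_unfold sum_distrib_left[symmetric])
    finally have good: "(\<Sum>(x, K)\<in>p2. \<bar>f (r K) - f (l K)\<bar>) \<le> \<epsilon> * (b - a)" .

    \<comment> \<open>Absolute continuity speaks of families indexed by \<open>{..<n}\<close>, so \<open>p1\<close> has to be enumerated.\<close>
    obtain h :: "nat \<Rightarrow> real \<times> real set" and n where h: "bij_betw h {..<n} p1"
      using ex_bij_betw_nat_finite[OF p12(3)] by (auto simp: atLeast0LessThan)
    define x y where "x i = l (snd (h i))" and "y i = r (snd (h i))" for i
    have hp: "(fst (h i), snd (h i)) \<in> p" "fst (h i) \<in> N" if "i < n" for i
      using bij_betwE[OF h] that by (force simp: p1_def)+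
    have xy: "a \<le> x i \<and> x i \<le> y i \<and> y i \<le> b" if "i < n" for i
      using K(2-5)[OF hp(1)[OF that]] by (auto simp: x_def y_def)
    have interior: "interior (snd (h i)) = {x i<..<y i}" if "i < n" for i
      using K(1)[OF hp(1)[OF that]] by (simp add: x_def y_def)
    have disj: "disjoint_family_on (\<lambda>i. {x i<..<y i}) {..<n}"
      unfolding disjoint_family_on_def
    proof (intro ballI impI)
      fix i j assume ij: "i \<in> {..<n}" "j \<in> {..<n}" "i \<noteq> j"
      then have "h i \<noteq> h j"
        using h by (auto simp: bij_betw_def inj_on_def)
      then show "{x i<..<y i} \<inter> {x j<..<y j} = {}"
        using pD(5)[OF hp(1) hp(1), of i j] ij interior by (auto simp: prod_eq_iff)
    qed
    have "(\<Sum>i<n. y i - x i) = (\<Sum>i<n. measure lebesgue {x i<..<y i})"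
      using xy by (intro sum.cong) auto
    also have "\<dots> = measure lebesgue (\<Union>i<n. {x i<..<y i})"
      using disj xy by (intro measure_finite_Union[symmetric]) auto
    also have "\<dots> \<le> measure lebesgue U"
    proof (rule measure_mono_fmeasurable[OF _ _ Um])
      show "(\<Union>i<n. {x i<..<y i}) \<subseteq> U"
      proof (rule UN_least)
        fix i assume "i \<in> {..<n}"
        then have "snd (h i) \<subseteq> U" "interior (snd (h i)) = {x i<..<y i}"
          using K(8)[OF hp(1)] hp(2) interior by (auto simp: G_def)
        then show "{x i<..<y i} \<subseteq> U" using interior_subset by blast
      qed
    qed auto
    finally have "(\<Sum>i<n. y i - x i) < \<delta>" using U_small by simp
    then have "(\<Sum>i<n. \<bar>f (y i) - f (x i)\<bar>) < \<epsilon>"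
      using \<delta> xy disj by blast
    moreover have "(\<Sum>(x, K)\<in>p1. \<bar>f (r K) - f (l K)\<bar>) = (\<Sum>i<n. \<bar>f (y i) - f (x i)\<bar>)"
      using sum.reindex_bij_betw[OF h, of "\<lambda>(x, K). \<bar>f (r K) - f (l K)\<bar>"]
      by (simp add: x_def y_def case_prod_unfold)
    ultimately show ?thesis using total good by (simp add: distrib_left)
  qed
  show ?thesis
  proof (rule ccontr)
    assume "f b \<noteq> f a"
    define c where "c = \<bar>f b - f a\<bar>"
    have "c > 0" using \<open>f b \<noteq> f a\<close> by (simp add: c_def)
    define w where "w = 1 + (b - a)"
    have "w > 0"
      using \<open>a \<le> b\<close> by (simp add: w_def)
    then have "c / (2 * w) > 0" "c / (2 * w) * w = c / 2"
      using \<open>c > 0\<close> by simp_all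
    with bound[of "c / (2 * w)"] have "c \<le> c / 2"
      by (simp only: c_def w_def)
    then show False
      using \<open>c > 0\<close> by simp
  qed
qed

section \<open>Fractional derivatives of periodic functions are not periodic\<close>

theorem corollary3p2:
  fixes T :: real and f :: "real \<Rightarrow> real"
  assumes "T > 0"
    and "periodic_fun_simple f T"
    and "locally_integrable f"
    and "\<not> (AE t in lebesgue. f t = 0)"
  shows "\<forall>\<alpha>\<in>{0<..<1}.
      (locally_absolutely_continuous f \<and> \<not> f constant_on UNIV \<longrightarrow> \<not> caputo_periodic \<alpha> f T) \<and>
      (\<not> (AE t in lebesgue. (f has_real_derivative 0) (at t)) \<longrightarrow> \<not> caputo_periodic \<alpha> f T) \<and>
      \<not> rl_periodic \<alpha> f T"
proof (intro ballI conjI impI notI)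
  fix \<alpha> :: real assume "\<alpha> \<in> {0<..<1}"
  then have \<alpha>: "0 < \<alpha>" "\<alpha> < 1" by auto
  show False
    if ac: "locally_absolutely_continuous f \<and> \<not> f constant_on UNIV" and caputo: "caputo_periodic \<alpha> f T"
  proof -
    have deriv: "AE t in lebesgue. (f has_real_derivative 0) (at t)"
      using AE_deriv_0_if_caputo_periodic[OF assms(1,2) \<alpha> caputo] .
    have "f b = f a" if "a \<le> b" for a b
      using absolutely_continuous_AE_deriv_0_imp_eq[OF _ that deriv] ac
      by (simp add: locally_absolutely_continuous_def)
    then have "f t = f 0" for t
      by (cases "0 \<le> t") (auto simp: not_le dest: less_imp_le)
    then show False
      using ac by (auto simp: constant_on_def)
  qed
  show False
    if "\<not> (AE t in lebesgue. (f has_real_derivative 0) (at t))" and "caputo_periodic \<alpha> f T"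
    using that AE_deriv_0_if_caputo_periodic[OF assms(1,2) \<alpha>] by blast
  show False if rl: "rl_periodic \<alpha> f T"
    using AE_eq_0_if_rl_periodic[OF assms(1,2) _ \<alpha> rl] assms(3,4)
    by (simp add: locally_integrable_def)
qed

end
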